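(* Let $X$ be a real random variable taking positive values, and let $m,n$ be non-negative integers such that $m+n>2$. If $D_m$ and $D_n$ are independent random variables distributed respectively like $m\odot X$ and $n\odot X$, then $$\Pr(D_m>D_n)=\frac{m}{m+n}.$$ In words: if two random walkers start at the origin of the plane and take respectively $m$ and $n$ independent steps with uniformly random directions and with lengths chosen independently according to the distribution of $X$, then the probability that the first walker ends farther from the origin than the second walker is $m/(m+n)$.
   Context: Work in the Euclidean plane. Given positive real random variables $X_1,\dots,X_n$, consider a walk starting at the origin made of $n$ steps of respective lengths $X_1,\dots,X_n$, where the direction of each step is chosen uniformly at random on the circle, independently of each other and of the lengths. Denote by $X_1\oplus X_2\oplus\cdots\oplus X_n$ the random variable equal to the distance between the origin and the endpoint of this walk (for $n=0$ this distance is $0$). For a non-negative real random variable $X$, $n\odot X$ denotes the random variable $X_1\oplus\cdots\oplus X_n$ where $X_1,\dots,X_n$ are independent copies of $X$; so $0\odot X=0$. *)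

theory Defs
  imports "HOL-Probability.Probability"
begin

text \<open>The plane is the type \<^typ>\<open>complex\<close>, and directions are points of its unit circle.\<close>

definition uniform_circle :: "complex measure" where
  "uniform_circle = distr (uniform_measure lborel {0..2 * pi}) borel cis"

text \<open>The law of \<open>X\<^sub>1 \<oplus> \<dots> \<oplus> X\<^sub>n\<close>, where the lengths \<open>X i\<close> (\<open>1 \<le> i \<le> n\<close>) are arbitrary
  random variables on a common space \<open>M\<close>. The product with \<open>n\<close> copies of the circle
  makes the directions independent of each other and of the lengths.\<close>

definition oplus_law :: "nat \<Rightarrow> 'a measure \<Rightarrow> (nat \<Rightarrow> 'a \<Rightarrow> real) \<Rightarrow> real measure" where
  "oplus_law n M X =
     distr (M \<Otimes>\<^sub>M Pi\<^sub>M {1..n} (\<lambda>_. uniform_circle)) borel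
       (\<lambda>(\<omega>, u). norm (\<Sum>i=1..n. X i \<omega> *\<^sub>R u i))"

text \<open>The law of \<open>n \<odot> X\<close>: the coordinates of the \<open>n\<close>-fold power of \<open>M\<close> provide \<open>n\<close>
  independent copies of \<open>X\<close>.\<close>

definition odot_law :: "nat \<Rightarrow> 'a measure \<Rightarrow> ('a \<Rightarrow> real) \<Rightarrow> real measure" where
  "odot_law n M X = oplus_law n (Pi\<^sub>M {1..n} (\<lambda>_. M)) (\<lambda>i \<omega>. X (\<omega> i))"

lemma sets_uniform_circle [measurable_cong, simp]: "sets uniform_circle = sets borel"
  by (simp add: uniform_circle_def)

lemma measurable_cis [measurable]: "cis \<in> borel_measurable borel"
  by (intro borel_measurable_continuous_onI continuous_intros)

lemma prob_space_uniform_circle: "prob_space uniform_circle"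
  unfolding uniform_circle_def
  by (intro prob_space.prob_space_distr prob_space_uniform_measure) auto

lemma prob_space_oplus_law:
  assumes "prob_space M" and [measurable]: "\<And>i. i \<in> {1..n} \<Longrightarrow> X i \<in> borel_measurable M"
  shows "prob_space (oplus_law n M X)"
proof -
  have "prob_space (Pi\<^sub>M {1..n} (\<lambda>_. uniform_circle))"
    by (intro prob_space_PiM prob_space_uniform_circle)
  then interpret pair_prob_space M "Pi\<^sub>M {1..n} (\<lambda>_. uniform_circle)"
    using assms(1) by (simp add: pair_prob_space_def pair_sigma_finite_def prob_space_imp_sigma_finite)
  show ?thesis
    unfolding oplus_law_def by (rule prob_space_distr) measurable
qed

lemma prob_space_odot_law:
  assumes "prob_space M" and [measurable]: "X \<in> borel_measurable M"
  shows "prob_space (odot_law n M X)"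
  unfolding odot_law_def
  by (rule prob_space_oplus_law) (auto intro!: prob_space_PiM assms(1))

lemma odot_law_0:
  assumes "prob_space M" and "X \<in> borel_measurable M"
  shows "odot_law 0 M X = return borel 0"
proof -
  have "prob_space (Pi\<^sub>M {1..0::nat} (\<lambda>_. M) \<Otimes>\<^sub>M Pi\<^sub>M {1..0::nat} (\<lambda>_. uniform_circle))"
    by (intro prob_space_pair prob_space_PiM assms(1) prob_space_uniform_circle)
  then show ?thesis
    by (simp add: odot_law_def oplus_law_def case_prod_unfold prob_space.distr_const)
qed

end

theory Submission
  imports Defs
begin

text \<open>Split an $N$-step walk into three independent isotropic pieces with $i + j + k = N$ steps and
  condition on the lengths $x, y, z$ of their displacements. The probability that the sum of the
  first two displacements is no longer than the third is $1 / \pi$ times the angle opposite to $z$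
  in the triangle with sides $x, y, z$ (and $0$ or $1$ if there is no such triangle), so the angle
  sum of a triangle shows that $h(k) = P(D_k \ge D_{N-k})$ satisfies $h(i) + h(j) + h(k) = 1$.
  Ties have probability $0$ when $N > 2$, so also $h(k) + h(N-k) = 1$; hence $h$ is
  additive and $h(k) = k / N$.\<close>

subsection \<open>Angles and the uniform distribution on the circle\<close>

text \<open>The factor 1 / pi arises as follows: adding a displacement of length x, in a uniform
  direction, to one of length y gives a vector of length at most z exactly when the turning angle,
  an exterior angle, has cosine at most minus the cosine of the angle opposite to z. This cuts out
  an arc twice as long as that angle from a circle of length 2 pi. Conditioning on lengths is done
  without conditional laws: multiplying an isotropic vector by an independent uniform unit vector
  preserves its law, so a uniform direction can be inserted into any integral and the original
  directions absorbed by rotation. The three probabilities then differ only in the order of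
  integration. A zero displacement has no direction. Hence all three pieces need at least one step,
  and the cases k = 0 and k = N stay outside the additivity argument. Ties are the reason for N > 2:
  two single steps of the same constant length always tie, whereas for N > 2 one of the two walks
  has at least two steps, and its endpoint lies on any given circle around the origin with
  probability 0.\<close>

lemma law_of_cosines_range:
  fixes r s t :: real
  assumes "r > 0" "s > 0" "t > 0" "r \<le> s + t" "s \<le> t + r" "t \<le> r + s"
  shows "- 1 \<le> (r\<^sup>2 + s\<^sup>2 - t\<^sup>2) / (2 * r * s) \<and> (r\<^sup>2 + s\<^sup>2 - t\<^sup>2) / (2 * r * s) \<le> 1"
proof -
  have "t\<^sup>2 \<le> (r + s)\<^sup>2" using assms by (intro power_mono) auto
  moreover have "(r - s)\<^sup>2 \<le> t\<^sup>2" using assms by (intro abs_le_square_iff[THEN iffD1]) auto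
  ultimately show ?thesis using assms(1,2)
    by (simp add: field_simps power2_eq_square)
qed

text \<open>The cosine addition formula yields that the cosine of the sum of two angles is minus the
  cosine of the third. As that sum lies between 0 and pi, \<open>arccos\<close> may be applied to
  this identity.\<close>

lemma triangle_angle_sum:
  fixes x y z :: real
  assumes pos: "x > 0" "y > 0" "z > 0"
    and tri: "x \<le> y + z" "y \<le> z + x" "z \<le> x + y"
  shows "arccos ((x\<^sup>2 + y\<^sup>2 - z\<^sup>2) / (2 * x * y)) + arccos ((y\<^sup>2 + z\<^sup>2 - x\<^sup>2) / (2 * y * z))
    + arccos ((z\<^sup>2 + x\<^sup>2 - y\<^sup>2) / (2 * z * x)) = pi"
proof -
  define a b c where "a = (y\<^sup>2 + z\<^sup>2 - x\<^sup>2) / (2 * y * z)"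
    and "b = (z\<^sup>2 + x\<^sup>2 - y\<^sup>2) / (2 * z * x)" and "c = (x\<^sup>2 + y\<^sup>2 - z\<^sup>2) / (2 * x * y)"
  have a: "- 1 \<le> a" "a \<le> 1" and b: "- 1 \<le> b" "b \<le> 1" and c: "- 1 \<le> c" "c \<le> 1"
    using law_of_cosines_range[of y z x] law_of_cosines_range[of z x y] law_of_cosines_range[of x y z] assms
    by (auto simp: a_def b_def c_def)
  \<comment> \<open>16 times the squared area of the triangle (Heron), hence symmetric in the three sides\<close>
  define H where "H = 4 * y\<^sup>2 * z\<^sup>2 - (y\<^sup>2 + z\<^sup>2 - x\<^sup>2)\<^sup>2"
  have sa: "1 - a\<^sup>2 = H / (2 * y * z)\<^sup>2" and sb: "1 - b\<^sup>2 = H / (2 * z * x)\<^sup>2"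
    using pos by (simp_all add: a_def b_def H_def field_simps power2_eq_square)
  have "0 \<le> 1 - a\<^sup>2" using a by (simp add: abs_square_le_1 abs_le_iff)
  then have H: "H \<ge> 0" using sa pos by (simp add: zero_le_divide_iff)
  \<comment> \<open>Both sines carry the same root of \<open>H\<close>, so their product is rational
    in the sides.\<close>
  have "sin (arccos a) * sin (arccos b) = H / ((2 * y * z) * (2 * z * x))"
    using a b H pos by (simp add: sin_arccos_abs sin_arccos sa sb real_sqrt_divide)
  also have "\<dots> = a * b + c"
    using pos by (simp add: a_def b_def c_def H_def field_simps power2_eq_square)
  finally have "cos (arccos a + arccos b) = - c"
    using a b by (simp add: cos_add)
  moreover have "arccos a + arccos b \<le> pi"
  proof -
    \<comment> \<open>The upper bound pi is equivalent to \<open>a + b \<ge> 0\<close>; in this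
      factorization the sign is decided by the triangle inequality for
      \<open>\<bar>x - y\<bar>\<close> and \<open>z\<close>.\<close>
    have "a + b = (x + y) * (z\<^sup>2 - (x - y)\<^sup>2) / (2 * x * y * z)"
      using pos by (simp add: a_def b_def field_simps power2_eq_square)
    moreover have "(x - y)\<^sup>2 \<le> z\<^sup>2" using tri pos by (intro abs_le_square_iff[THEN iffD1]) auto
    ultimately have "0 \<le> a + b" using pos by simp
    then have "- b \<le> a" by simp
    then have "arccos a \<le> arccos (- b)" using a b by (intro arccos_le_arccos) auto
    then show ?thesis using b by (simp add: arccos_minus)
  qed
  moreover have "0 \<le> arccos a + arccos b" using a b by (simp add: arccos_lbound)
  ultimately have "arccos (- c) = arccos a + arccos b" using arccos_cos by metis
  then show ?thesis using c by (simp add: arccos_minus a_def b_def c_def)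
qed

text \<open>The solutions form an arc centred at pi with half-width \<open>arccos t\<close>.
  Monotonicity of the cosine settles the half up to pi, and the reflection of \<theta> to
  \<open>2 * pi - \<theta>\<close> gives the other half.\<close>

lemma cos_le_neg_iff:
  assumes "0 \<le> \<theta>" "\<theta> \<le> 2 * pi" "- 1 \<le> t" "t \<le> 1"
  shows "cos \<theta> \<le> - t \<longleftrightarrow> pi - arccos t \<le> \<theta> \<and> \<theta> \<le> pi + arccos t"
proof -
  have *: "cos \<phi> \<le> - t \<longleftrightarrow> pi - arccos t \<le> \<phi>" if "0 \<le> \<phi>" "\<phi> \<le> pi" for \<phi>
  proof -
    have "cos \<phi> \<le> cos (pi - arccos t) \<longleftrightarrow> pi - arccos t \<le> \<phi>"
      using that assms arccos_lbound[of t] arccos_ubound[of t] by (intro cos_mono_le_eq) auto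
    then show ?thesis using assms by simp
  qed
  show ?thesis
  proof (cases "\<theta> \<le> pi")
    case True
    then show ?thesis using *[of \<theta>] assms arccos_lbound[of t] by auto
  next
    case False
    then show ?thesis using *[of "2 * pi - \<theta>"] assms arccos_lbound[of t] by auto
  qed
qed

section \<open>The uniform direction: arcs, rotation invariance, null sets\<close>

lemma emeasure_uniform_circle:
  assumes "A \<in> sets borel"
  shows "emeasure uniform_circle A = emeasure lborel ({0..2 * pi} \<inter> cis -` A) / ennreal (2 * pi)"
  using assms measurable_sets[OF measurable_cis assms]
  by (simp add: uniform_circle_def emeasure_distr)

text \<open>Clamping \<open>t\<close> to [-1, 1] lets one formula also cover the empty set
  (\<open>t > 1\<close>, angle 0) and the whole circle (\<open>t < - 1\<close>, angle pi).\<close>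

lemma emeasure_uniform_circle_Re_le:
  "emeasure uniform_circle {u. Re u \<le> - t} = ennreal (arccos (max (- 1) (min 1 t)) / pi)"
proof -
  define s where "s = max (- 1) (min 1 t)"
  have s: "- 1 \<le> s" "s \<le> 1" by (auto simp: s_def)
  have [measurable]: "{u. Re u \<le> - t} \<in> sets borel" by measurable
  have "emeasure lborel ({0..2 * pi} \<inter> cis -` {u. Re u \<le> - t}) = ennreal (2 * arccos s)"
  proof (cases "t \<le> 1")
    case True
    have "cos \<theta> \<le> - t \<longleftrightarrow> cos \<theta> \<le> - s" for \<theta>
      using True cos_le_one[of \<theta>] unfolding s_def by linarith
    then have "{0..2 * pi} \<inter> cis -` {u. Re u \<le> - t} = {\<theta> \<in> {0..2 * pi}. cos \<theta> \<le> - s}"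
      by auto
    also have "\<dots> = {pi - arccos s .. pi + arccos s}"
      using cos_le_neg_iff[OF _ _ s] arccos_ubound[OF s] arccos_lbound[OF s] by fastforce
    finally have "{0..2 * pi} \<inter> cis -` {u. Re u \<le> - t} = \<dots>" .
    then show ?thesis using arccos_lbound[OF s] by simp
  next
    case False
    then have "\<not> cos \<theta> \<le> - t" for \<theta>
      using cos_ge_minus_one[of \<theta>] by linarith
    then have "{0..2 * pi} \<inter> cis -` {u. Re u \<le> - t} = {}"
      by auto
    then show ?thesis using False by (simp add: s_def)
  qed
  then show ?thesis
    unfolding s_def[symmetric] using arccos_lbound[OF s]
    by (simp add: emeasure_uniform_circle divide_ennreal)
qed

lemma nn_integral_uniform_circle:
  assumes [measurable]: "f \<in> borel_measurable borel"
  shows "(\<integral>\<^sup>+u. f u \<partial>uniform_circle)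
    = (\<integral>\<^sup>+\<theta>. f (cis \<theta>) * indicator {0..2 * pi} \<theta> \<partial>lborel) / ennreal (2 * pi)"
proof -
  have "(\<integral>\<^sup>+u. f u \<partial>uniform_circle)
    = (\<integral>\<^sup>+\<theta>. f (cis \<theta>) \<partial>uniform_measure lborel {0..2 * pi})"
    unfolding uniform_circle_def by (rule nn_integral_distr) auto
  also have "\<dots> = (\<integral>\<^sup>+\<theta>. f (cis \<theta>) * indicator {0..2 * pi} \<theta> \<partial>lborel) / emeasure lborel {0..2*pi}"
    by (rule nn_integral_uniform_measure) auto
  finally show ?thesis by simp
qed

text \<open>In the angular parameter a rotation by \<phi> moves the interval from 0 to 2 pi to the
  one from \<phi> to \<phi> + 2 pi. The overhang past 2 pi is cut off and shifted back by one
  period.\<close>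

lemma nn_integral_uniform_circle_rotate:
  assumes [measurable]: "f \<in> borel_measurable borel" and c: "norm c = 1"
  shows "(\<integral>\<^sup>+u. f (c * u) \<partial>uniform_circle) = (\<integral>\<^sup>+u. f u \<partial>uniform_circle)"
proof -
  obtain \<phi> where \<phi>: "0 \<le> \<phi>" "\<phi> < 2 * pi" "c = cis \<phi>"
    using sincos_total_2pi[of "Re c" "Im c"] c by (metis cis.code complex_surj cmod_power2 one_power2)
  define g where "g \<theta> = f (cis \<theta>)" for \<theta>
  have [measurable]: "g \<in> borel_measurable borel" unfolding g_def by measurable
  have AE_neq: "AE \<theta> in lborel. \<theta> \<noteq> \<psi>" for \<psi> :: real
    by (rule AE_lborel_singleton)
  have "(\<integral>\<^sup>+\<theta>. f (c * cis \<theta>) * indicator {0..2 * pi} \<theta> \<partial>lborel)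
     = (\<integral>\<^sup>+\<theta>. g (\<phi> + \<theta>) * indicator {\<phi>..2 * pi} (\<phi> + \<theta>)
          + g (\<phi> - 2 * pi + \<theta>) * indicator {0..\<phi>} (\<phi> - 2 * pi + \<theta>) \<partial>lborel)"
  \<comment> \<open>Both indicators equal 1 at the cut \<open>2 * pi - \<phi>\<close>, so this
    single point must be discarded; the same happens at \<open>\<phi>\<close> when the pieces are
    glued again.\<close>
  proof (rule nn_integral_cong_AE, use AE_neq[of "2 * pi - \<phi>"] in eventually_elim)
    case (elim \<theta>)
    have "cis (\<phi> - 2 * pi + \<theta>) = cis (\<phi> + \<theta>)"
      using cis_divide[of "\<phi> + \<theta>" "2 * pi"] by (simp add: add_diff_eq diff_add_eq)
    then have "g (\<phi> - 2 * pi + \<theta>) = g (\<phi> + \<theta>)" "f (c * cis \<theta>) = g (\<phi> + \<theta>)"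
      by (simp_all add: g_def \<phi> cis_mult)
    then show ?case using elim \<phi>(1,2) by (cases "\<theta> \<le> 2 * pi - \<phi>") (simp_all add: indicator_def)
  qed
  also have "\<dots> = (\<integral>\<^sup>+\<theta>. g (\<phi> + \<theta>) * indicator {\<phi>..2 * pi} (\<phi> + \<theta>) \<partial>lborel)
      + (\<integral>\<^sup>+\<theta>. g (\<phi> - 2 * pi + \<theta>) * indicator {0..\<phi>} (\<phi> - 2 * pi + \<theta>) \<partial>lborel)"
    by (rule nn_integral_add) measurable
  also have "\<dots> = (\<integral>\<^sup>+\<theta>. g \<theta> * indicator {\<phi>..2 * pi} \<theta> \<partial>lborel)
      + (\<integral>\<^sup>+\<theta>. g \<theta> * indicator {0..\<phi>} \<theta> \<partial>lborel)"
    using nn_integral_real_affine[of "\<lambda>\<theta>. g \<theta> * indicator {\<phi>..2 * pi} \<theta>" 1 \<phi>]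
      nn_integral_real_affine[of "\<lambda>\<theta>. g \<theta> * indicator {0..\<phi>} \<theta>" 1 "\<phi> - 2 * pi"] by simp
  also have "\<dots> = (\<integral>\<^sup>+\<theta>. g \<theta> * indicator {\<phi>..2 * pi} \<theta> + g \<theta> * indicator {0..\<phi>} \<theta> \<partial>lborel)"
    by (rule nn_integral_add[symmetric]) measurable
  also have "\<dots> = (\<integral>\<^sup>+\<theta>. g \<theta> * indicator {0..2 * pi} \<theta> \<partial>lborel)"
  proof (rule nn_integral_cong_AE, use AE_neq[of \<phi>] in eventually_elim)
    case (elim \<theta>)
    then show ?case using \<phi>(1,2) by (cases "\<theta> \<le> \<phi>") (simp_all add: indicator_def)
  qed
  finally show ?thesis
    by (simp add: nn_integral_uniform_circle g_def)
qed

lemma emeasure_uniform_circle_Re_eq: "emeasure uniform_circle {u. Re u = t} = 0"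
proof -
  have "\<theta> = arccos t \<or> \<theta> = 2 * pi - arccos t" if "0 \<le> \<theta>" "\<theta> \<le> 2 * pi" "cos \<theta> = t" for \<theta>
    using that arccos_cos[of \<theta>] arccos_cos[of "2 * pi - \<theta>"] by (cases "\<theta> \<le> pi") auto
  then have "{0..2 * pi} \<inter> cis -` {u. Re u = t} \<subseteq> {arccos t, 2 * pi - arccos t}"
    by fastforce
  then have "finite ({0..2 * pi} \<inter> cis -` {u. Re u = t})"
    by (rule finite_subset) auto
  moreover have "{u. Re u = t} \<in> sets borel" by measurable
  ultimately show ?thesis
    by (simp add: emeasure_uniform_circle emeasure_lborel_countable countable_finite)
qed

lemma AE_uniform_circle_norm: "AE u in uniform_circle. norm u = 1"
  unfolding uniform_circle_def by (subst AE_distr_iff) auto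

text \<open>This is the law of cosines; the sign is plus because \<open>Re u\<close> is the cosine
  of the exterior angle between the two displacements.\<close>

lemma norm_of_real_mult_add:
  assumes "norm u = 1"
  shows "(norm (of_real x * u + of_real y))\<^sup>2 = x\<^sup>2 + y\<^sup>2 + 2 * x * y * Re u"
proof -
  have "(Re u)\<^sup>2 + (Im u)\<^sup>2 = 1" using assms by (metis cmod_power2 one_power2)
  then have "x\<^sup>2 * (Re u)\<^sup>2 + x\<^sup>2 * (Im u)\<^sup>2 = x\<^sup>2"
    by (metis distrib_left mult.right_neutral)
  then show ?thesis
    unfolding cmod_power2 by (simp add: algebra_simps power2_eq_square)
qed

lemma emeasure_uniform_circle_norm_eq:
  assumes "x > 0" "y > 0"
  shows "emeasure uniform_circle {u. norm (of_real x * u + of_real y) = z} = 0"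
proof -
  have "emeasure uniform_circle {u. norm (of_real x * u + of_real y) = z}
    \<le> emeasure uniform_circle {u. Re u = (z\<^sup>2 - x\<^sup>2 - y\<^sup>2) / (2 * x * y)}"
    by (intro emeasure_mono_AE, use AE_uniform_circle_norm in eventually_elim)
       (use norm_of_real_mult_add[of _ x y] assms in \<open>auto simp: field_simps\<close>)
  then show ?thesis by (simp add: emeasure_uniform_circle_Re_eq)
qed

lemma emeasure_uniform_circle_norm_le:
  assumes "x > 0" "y > 0" "z > 0"
  shows "emeasure uniform_circle {u. norm (of_real x * u + of_real y) \<le> z}
    = ennreal (arccos (max (- 1) (min 1 ((x\<^sup>2 + y\<^sup>2 - z\<^sup>2) / (2 * x * y)))) / pi)"
proof -
  have "emeasure uniform_circle {u. norm (of_real x * u + of_real y) \<le> z}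
    = emeasure uniform_circle {u. Re u \<le> - ((x\<^sup>2 + y\<^sup>2 - z\<^sup>2) / (2 * x * y))}"
  proof (intro emeasure_eq_AE, use AE_uniform_circle_norm in eventually_elim)
    case (elim u)
    have "norm (of_real x * u + of_real y) \<le> z \<longleftrightarrow> (norm (of_real x * u + of_real y))\<^sup>2 \<le> z\<^sup>2"
      using assms(3) by (simp add: abs_le_square_iff[symmetric])
    also have "\<dots> \<longleftrightarrow> x\<^sup>2 + y\<^sup>2 + 2 * x * y * Re u \<le> z\<^sup>2"
      by (simp add: norm_of_real_mult_add[OF elim])
    also have "\<dots> \<longleftrightarrow> Re u \<le> - ((x\<^sup>2 + y\<^sup>2 - z\<^sup>2) / (2 * x * y))"
      using assms by (simp add: field_simps)
    finally show ?case by simp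
  qed auto
  then show ?thesis by (simp only: emeasure_uniform_circle_Re_le)
qed

text \<open>The probability that two displacements of lengths \<open>x\<close> and \<open>y\<close>
  at a uniform relative angle end within distance \<open>z\<close> of the origin. The integral form
  fits directly into the iterated integrals below.\<close>

definition turn :: "real \<Rightarrow> real \<Rightarrow> real \<Rightarrow> ennreal" where
  "turn x y z = (\<integral>\<^sup>+u. indicator {..z} (norm (of_real x * u + of_real y)) \<partial>uniform_circle)"

lemma turn_eq:
  assumes "x > 0" "y > 0" "z > 0"
  shows "turn x y z = ennreal (arccos (max (- 1) (min 1 ((x\<^sup>2 + y\<^sup>2 - z\<^sup>2) / (2 * x * y)))) / pi)"
proof -
  have "turn x y z = (\<integral>\<^sup>+u. indicator {u. norm (of_real x * u + of_real y) \<le> z} u \<partial>uniform_circle)"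
    unfolding turn_def by (intro nn_integral_cong) (auto split: split_indicator)
  also have "\<dots> = emeasure uniform_circle {u. norm (of_real x * u + of_real y) \<le> z}"
    by (rule nn_integral_indicator) simp
  finally show ?thesis by (simp only: emeasure_uniform_circle_norm_le[OF assms])
qed

text \<open>If a triangle with these sides exists, the three terms are its angles divided by pi.
  Otherwise one side exceeds the sum of the other two and the clamps turn the three angles into pi,
  0 and 0, with the same sum.\<close>

lemma turn_cyclic_sum:
  assumes "x > 0" "y > 0" "z > 0"
  shows "turn x y z + turn y z x + turn z x y = 1"
proof -
  define ang where "ang r s t = arccos (max (- 1) (min 1 ((r\<^sup>2 + s\<^sup>2 - t\<^sup>2) / (2 * r * s))))"
    for r s t :: real
  have degenerate: "ang r s t = pi \<and> ang s t r = 0 \<and> ang t r s = 0"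
    if "r > 0" "s > 0" "t > r + s" for r s t
  proof -
    \<comment> \<open>Each of these inequalities pushes one of the three cosine expressions to or
      beyond its clamp.\<close>
    have "(r + s)\<^sup>2 \<le> t\<^sup>2" "s\<^sup>2 \<le> (t - r)\<^sup>2" "r\<^sup>2 \<le> (t - s)\<^sup>2"
      using that by (auto intro!: power_mono)
    then have "(r\<^sup>2 + s\<^sup>2 - t\<^sup>2) / (2 * r * s) \<le> - 1" "1 \<le> (s\<^sup>2 + t\<^sup>2 - r\<^sup>2) / (2 * s * t)"
      "1 \<le> (t\<^sup>2 + r\<^sup>2 - s\<^sup>2) / (2 * t * r)"
      using that by (simp_all add: field_simps power2_eq_square)
    then show ?thesis
      by (simp add: ang_def max_def min_def)
  qed
  have "ang x y z + ang y z x + ang z x y = pi"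
  proof (cases "x \<le> y + z \<and> y \<le> z + x \<and> z \<le> x + y")
    case True
    have "ang r s t = arccos ((r\<^sup>2 + s\<^sup>2 - t\<^sup>2) / (2 * r * s))"
      if "r > 0" "s > 0" "t > 0" "r \<le> s + t" "s \<le> t + r" "t \<le> r + s" for r s t
      using law_of_cosines_range[OF that] by (simp add: ang_def)
    then show ?thesis
      using triangle_angle_sum[of x y z] assms True by simp
  next
    case False
    then consider "z > x + y" | "x > y + z" | "y > z + x" by linarith
    then show ?thesis
    proof cases
      case 1
      then show ?thesis using degenerate[of x y z] assms by simp
    next
      case 2
      then show ?thesis using degenerate[of y z x] assms by simp
    next
      case 3
      then show ?thesis using degenerate[of z x y] assms by simp
    qed
  qed
  moreover have "0 \<le> ang r s t" for r s t
    unfolding ang_def by (intro arccos_lbound) auto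
  moreover have "turn x y z + turn y z x + turn z x y
    = ennreal (ang x y z / pi) + ennreal (ang y z x / pi) + ennreal (ang z x y / pi)"
    unfolding ang_def using assms
    by (simp only: turn_eq)
  moreover have "ang x y z / pi + ang y z x / pi + ang z x y / pi
    = (ang x y z + ang y z x + ang z x y) / pi"
    by (simp add: add_divide_distrib)
  ultimately show ?thesis
    by (simp flip: ennreal_plus)
qed

subsection \<open>Isotropic laws in the plane\<close>

definition isotropic :: "complex measure \<Rightarrow> bool" where
  "isotropic A \<longleftrightarrow> prob_space A \<and> sets A = sets borel \<and> (\<forall>c. norm c = 1 \<longrightarrow> distr A borel ((*) c) = A)"

definition conv :: "complex measure \<Rightarrow> complex measure \<Rightarrow> complex measure" where
  "conv A B = distr (A \<Otimes>\<^sub>M B) borel (\<lambda>(a, b). a + b)"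

text \<open>Ties count for the first argument; this is the non-strict probability called h in the
  overview.\<close>

definition farther :: "complex measure \<Rightarrow> complex measure \<Rightarrow> ennreal" where
  "farther A B = (\<integral>\<^sup>+a. \<integral>\<^sup>+b. indicator {..norm a} (norm b) \<partial>B \<partial>A)"

lemma borel_measurable_indicator_atMost [measurable (raw)]:
  fixes f g :: "'a \<Rightarrow> real"
  assumes [measurable]: "f \<in> borel_measurable M" "g \<in> borel_measurable M"
  shows "(\<lambda>w. indicator {..f w} (g w) :: ennreal) \<in> borel_measurable M"
  unfolding indicator_def atMost_iff by measurable

lemma borel_measurable_turn [measurable (raw)]:
  assumes [measurable]: "f \<in> borel_measurable M" "g \<in> borel_measurable M" "h \<in> borel_measurable M"
  shows "(\<lambda>w. turn (f w) (g w) (h w)) \<in> borel_measurable M"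
proof -
  interpret prob_space uniform_circle by (rule prob_space_uniform_circle)
  show ?thesis unfolding turn_def by measurable
qed

lemma isotropicD:
  assumes "isotropic A"
  shows isotropic_prob_space: "prob_space A"
    and sets_isotropic: "sets A = sets borel"
    and isotropic_distr: "norm c = 1 \<Longrightarrow> distr A borel ((*) c) = A"
  using assms by (auto simp: isotropic_def)

lemma nn_integral_isotropic_rotate:
  assumes A: "isotropic A" and [measurable]: "f \<in> borel_measurable borel" and c: "norm c = 1"
  shows "(\<integral>\<^sup>+a. f (c * a) \<partial>A) = (\<integral>\<^sup>+a. f a \<partial>A)"
proof -
  note [measurable_cong] = sets_isotropic[OF A]
  have "(\<integral>\<^sup>+a. f (c * a) \<partial>A) = (\<integral>\<^sup>+a. f a \<partial>distr A borel ((*) c))"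
    by (rule nn_integral_distr[symmetric]) measurable
  then show ?thesis by (simp add: isotropic_distr[OF A c])
qed

lemma isotropicI:
  assumes A: "prob_space A" "sets A = sets borel"
    and rot: "\<And>c f. norm c = 1 \<Longrightarrow> f \<in> borel_measurable borel \<Longrightarrow>
      (\<integral>\<^sup>+a. f (c * a) \<partial>A) = (\<integral>\<^sup>+a. f a \<partial>A)"
  shows "isotropic A"
proof -
  have "distr A borel ((*) c) = A" if "norm c = 1" for c
  proof (rule measure_eqI)
    note [measurable_cong] = A(2)
    show "sets (distr A borel ((*) c)) = sets A" by (simp add: A)
    fix S assume "S \<in> sets (distr A borel ((*) c))"
    then have S [measurable]: "S \<in> sets borel" by simp
    have "emeasure (distr A borel ((*) c)) S = (\<integral>\<^sup>+a. indicator S a \<partial>distr A borel ((*) c))"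
      by simp
    also have "\<dots> = (\<integral>\<^sup>+a. indicator S (c * a) \<partial>A)"
      by (rule nn_integral_distr) measurable
    also have "\<dots> = emeasure A S" using that by (simp add: rot A)
    finally show "emeasure (distr A borel ((*) c)) S = emeasure A S" .
  qed
  then show ?thesis using A by (simp add: isotropic_def)
qed

lemma nn_integral_borel_swap:
  fixes A B :: "complex measure"
  assumes "prob_space A" "prob_space B" and [measurable_cong]: "sets A = sets borel" "sets B = sets borel"
    and [measurable]: "case_prod f \<in> borel_measurable (borel \<Otimes>\<^sub>M borel)"
  shows "(\<integral>\<^sup>+a. \<integral>\<^sup>+b. f a b \<partial>B \<partial>A) = (\<integral>\<^sup>+b. \<integral>\<^sup>+a. f a b \<partial>A \<partial>B)"
proof -
  interpret A: prob_space A by fact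
  interpret B: prob_space B by fact
  interpret pair_sigma_finite A B ..
  show ?thesis by (rule Fubini'[symmetric]) measurable
qed

text \<open>After exchanging the integrals, each fixed unit \<open>u\<close> is a rotation and
  leaves the inner integral unchanged. This supplies an explicit uniform direction independent of
  the vector.\<close>

lemma isotropic_average:
  assumes A: "isotropic A" and [measurable]: "f \<in> borel_measurable borel"
  shows "(\<integral>\<^sup>+a. f a \<partial>A) = (\<integral>\<^sup>+a. \<integral>\<^sup>+u. f (u * a) \<partial>uniform_circle \<partial>A)"
proof -
  interpret A: prob_space A by (rule isotropic_prob_space[OF A])
  interpret U: prob_space uniform_circle by (rule prob_space_uniform_circle)
  have "(\<integral>\<^sup>+a. \<integral>\<^sup>+u. f (u * a) \<partial>uniform_circle \<partial>A)
    = (\<integral>\<^sup>+u. \<integral>\<^sup>+a. f (u * a) \<partial>A \<partial>uniform_circle)"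
    by (intro nn_integral_borel_swap A.prob_space_axioms U.prob_space_axioms sets_isotropic[OF A]
      sets_uniform_circle) measurable
  also have "\<dots> = (\<integral>\<^sup>+u. (\<integral>\<^sup>+a. f a \<partial>A) \<partial>uniform_circle)"
    by (intro nn_integral_cong_AE, use AE_uniform_circle_norm in eventually_elim)
       (rule nn_integral_isotropic_rotate[OF A], auto)
  finally show ?thesis by (simp add: U.emeasure_space_1)
qed

lemma sets_conv [measurable_cong, simp]: "sets (conv A B) = sets borel"
  by (simp add: conv_def)

lemma
  assumes "prob_space A" "prob_space B" and [measurable_cong]: "sets A = sets borel" "sets B = sets borel"
  shows prob_space_conv: "prob_space (conv A B)"
    and nn_integral_conv: "f \<in> borel_measurable borel \<Longrightarrow>
      (\<integral>\<^sup>+w. f w \<partial>conv A B) = (\<integral>\<^sup>+a. \<integral>\<^sup>+b. f (a + b) \<partial>B \<partial>A)"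
proof -
  interpret A: prob_space A by fact
  interpret B: prob_space B by fact
  interpret pair_prob_space A B ..
  show "prob_space (conv A B)"
    unfolding conv_def by (rule prob_space_distr) measurable
  assume [measurable]: "f \<in> borel_measurable borel"
  have "(\<integral>\<^sup>+w. f w \<partial>conv A B) = (\<integral>\<^sup>+p. f (fst p + snd p) \<partial>(A \<Otimes>\<^sub>M B))"
    unfolding conv_def by (subst nn_integral_distr) (auto simp: case_prod_beta)
  also have "\<dots> = (\<integral>\<^sup>+a. \<integral>\<^sup>+b. f (a + b) \<partial>B \<partial>A)"
    by (subst B.nn_integral_fst[symmetric]) auto
  finally show "(\<integral>\<^sup>+w. f w \<partial>conv A B) = (\<integral>\<^sup>+a. \<integral>\<^sup>+b. f (a + b) \<partial>B \<partial>A)" .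
qed

lemma isotropic_conv:
  assumes A: "isotropic A" and B: "isotropic B"
  shows "isotropic (conv A B)"
proof (rule isotropicI)
  note AB = isotropicD(1,2)[OF A] isotropicD(1,2)[OF B]
  interpret B: prob_space B by (rule AB)
  note [measurable_cong] = AB(2,4)
  show "prob_space (conv A B)" by (rule prob_space_conv) (fact AB)+
  fix c :: complex and f :: "complex \<Rightarrow> ennreal"
  assume c: "norm c = 1" and [measurable]: "f \<in> borel_measurable borel"
  have "(\<integral>\<^sup>+w. f (c * w) \<partial>conv A B) = (\<integral>\<^sup>+a. \<integral>\<^sup>+b. f (c * a + c * b) \<partial>B \<partial>A)"
    by (subst nn_integral_conv) (simp_all add: AB distrib_left)
  also have "\<dots> = (\<integral>\<^sup>+a. \<integral>\<^sup>+b. f (c * a + b) \<partial>B \<partial>A)"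
    by (intro nn_integral_cong nn_integral_isotropic_rotate[OF B _ c]) measurable
  also have "\<dots> = (\<integral>\<^sup>+a. \<integral>\<^sup>+b. f (a + b) \<partial>B \<partial>A)"
    by (rule nn_integral_isotropic_rotate[OF A _ c, of "\<lambda>a. \<integral>\<^sup>+b. f (a + b) \<partial>B"]) measurable
  also have "\<dots> = (\<integral>\<^sup>+w. f w \<partial>conv A B)"
    by (subst nn_integral_conv) (simp_all add: AB)
  finally show "(\<integral>\<^sup>+w. f (c * w) \<partial>conv A B) = (\<integral>\<^sup>+w. f w \<partial>conv A B)" .
qed simp

lemma borel_measure_eqI_nn_integral:
  assumes "sets A = sets borel" "sets B = sets borel"
    and "\<And>f :: complex \<Rightarrow> ennreal. f \<in> borel_measurable borel \<Longrightarrow> (\<integral>\<^sup>+a. f a \<partial>A) = (\<integral>\<^sup>+a. f a \<partial>B)"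
  shows "A = B"
proof (rule measure_eqI)
  fix S assume S: "S \<in> sets A"
  then show "emeasure A S = emeasure B S"
    using assms(3)[of "indicator S"] assms(1,2) by simp
qed (simp add: assms)

lemma conv_assoc:
  assumes A: "prob_space A" "sets A = sets borel" and B: "prob_space B" "sets B = sets borel"
    and C: "prob_space C" "sets C = sets borel"
  shows "conv (conv A B) C = conv A (conv B C)"
proof (rule borel_measure_eqI_nn_integral)
  note [measurable_cong] = A(2) B(2) C(2)
  interpret C: prob_space C by fact
  interpret B: prob_space B by fact
  fix f :: "complex \<Rightarrow> ennreal" assume [measurable]: "f \<in> borel_measurable borel"
  have "(\<integral>\<^sup>+a. f a \<partial>conv (conv A B) C) = (\<integral>\<^sup>+w. \<integral>\<^sup>+c. f (w + c) \<partial>C \<partial>conv A B)"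
    by (rule nn_integral_conv) (simp_all add: A B C prob_space_conv)
  also have "\<dots> = (\<integral>\<^sup>+a. \<integral>\<^sup>+b. \<integral>\<^sup>+c. f (a + b + c) \<partial>C \<partial>B \<partial>A)"
    by (rule nn_integral_conv) (simp_all add: A B C prob_space_conv)
  also have "\<dots> = (\<integral>\<^sup>+a. \<integral>\<^sup>+w. f (a + w) \<partial>conv B C \<partial>A)"
    by (rule nn_integral_cong, subst nn_integral_conv) (simp_all add: A B C prob_space_conv add.assoc)
  also have "\<dots> = (\<integral>\<^sup>+a. f a \<partial>conv A (conv B C))"
    by (rule nn_integral_conv[symmetric]) (simp_all add: A B C prob_space_conv)
  finally show "(\<integral>\<^sup>+a. f a \<partial>conv (conv A B) C) = (\<integral>\<^sup>+a. f a \<partial>conv A (conv B C))" .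
qed simp_all

text \<open>Factoring out the direction of \<open>b\<close> does not change the norm, and the
  remaining relative direction \<open>c\<close> of \<open>a\<close> is absorbed into
  \<open>u\<close> by rotation invariance.\<close>

lemma nn_integral_uniform_circle_norm_mult_add:
  assumes "a \<noteq> 0" "b \<noteq> 0" and [measurable]: "f \<in> borel_measurable borel"
  shows "(\<integral>\<^sup>+u. f (norm (u * a + b)) \<partial>uniform_circle)
    = (\<integral>\<^sup>+u. f (norm (of_real (norm a) * u + of_real (norm b))) \<partial>uniform_circle)"
proof -
  define c where "c = sgn a / sgn b"
  have c: "norm c = 1" using assms by (simp add: c_def norm_divide norm_sgn)
  have "norm (u * a + b) = norm (of_real (norm a) * (c * u) + of_real (norm b))" for u
  proof -
    have "u * a + b = sgn b * (of_real (norm a) * (c * u) + of_real (norm b))"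
      using assms by (simp add: c_def sgn_eq field_simps sgn_zero_iff)
    then show ?thesis using assms by (simp add: norm_mult norm_sgn)
  qed
  then show ?thesis
    using nn_integral_uniform_circle_rotate[OF _ c,
        of "\<lambda>u. f (norm (of_real (norm a) * u + of_real (norm b)))"] by simp
qed

section \<open>Comparing independent isotropic displacements through their lengths\<close>

lemma AE_neq_0:
  assumes "isotropic A" "emeasure A {0} = 0"
  shows "AE a in A. a \<noteq> 0"
  using assms by (intro AE_I[of _ _ "{0}"]) (auto simp: sets_isotropic)

lemma isotropic_average_norm:
  assumes A: "isotropic A" and A0: "emeasure A {0} = 0" and "b \<noteq> 0"
    and [measurable]: "f \<in> borel_measurable borel"
  shows "(\<integral>\<^sup>+a. f (norm (b + a)) \<partial>A)
    = (\<integral>\<^sup>+a. \<integral>\<^sup>+u. f (norm (of_real (norm a) * u + of_real (norm b))) \<partial>uniform_circle \<partial>A)"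
proof -
  have "(\<integral>\<^sup>+a. \<integral>\<^sup>+u. f (norm (u * a + b)) \<partial>uniform_circle \<partial>A)
    = (\<integral>\<^sup>+a. \<integral>\<^sup>+u. f (norm (of_real (norm a) * u + of_real (norm b))) \<partial>uniform_circle \<partial>A)"
    using AE_neq_0[OF A A0]
    by (intro nn_integral_cong_AE, eventually_elim)
       (rule nn_integral_uniform_circle_norm_mult_add, use assms in auto)
  then show ?thesis
    by (subst isotropic_average[OF A]) (auto simp: add.commute)
qed

lemma farther_conv:
  assumes A: "isotropic A" "emeasure A {0} = 0" and B: "isotropic B" "emeasure B {0} = 0"
    and C: "isotropic C"
  shows "farther C (conv B A) = (\<integral>\<^sup>+c. \<integral>\<^sup>+b. \<integral>\<^sup>+a. turn (norm a) (norm b) (norm c) \<partial>A \<partial>B \<partial>C)"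
  unfolding farther_def
proof (rule nn_integral_cong)
  fix c :: complex
  have "(\<integral>\<^sup>+w. indicator {..norm c} (norm w) \<partial>conv B A)
    = (\<integral>\<^sup>+b. \<integral>\<^sup>+a. indicator {..norm c} (norm (b + a) :: real) \<partial>A \<partial>B)"
    by (rule nn_integral_conv) (simp_all add: isotropicD(1,2) A B)
  also have "\<dots> = (\<integral>\<^sup>+b. \<integral>\<^sup>+a. turn (norm a) (norm b) (norm c) \<partial>A \<partial>B)"
    using AE_neq_0[OF B] unfolding turn_def
    by (intro nn_integral_cong_AE, eventually_elim)
       (rule isotropic_average_norm, use A in auto)
  finally show "(\<integral>\<^sup>+w. indicator {..norm c} (norm w) \<partial>conv B A)
    = (\<integral>\<^sup>+b. \<integral>\<^sup>+a. turn (norm a) (norm b) (norm c) \<partial>A \<partial>B)" .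
qed

text \<open>The order of the arguments of \<open>conv\<close> makes the three terms cyclic instances
  of \<open>farther_conv\<close>. Once Fubini has brought them to a common order of integration,
  \<open>turn_cyclic_sum\<close> makes the summed integrand 1 almost everywhere.\<close>

lemma farther_cyclic_sum:
  assumes A: "isotropic A" "emeasure A {0} = 0" and B: "isotropic B" "emeasure B {0} = 0"
    and C: "isotropic C" "emeasure C {0} = 0"
  shows "farther C (conv B A) + farther A (conv C B) + farther B (conv A C) = 1"
proof -
  note [measurable_cong] = sets_isotropic[OF A(1)] sets_isotropic[OF B(1)] sets_isotropic[OF C(1)]
  note isos = isotropicD(1,2)[OF A(1)] isotropicD(1,2)[OF B(1)] isotropicD(1,2)[OF C(1)]
  interpret A: prob_space A by (rule isos)
  interpret B: prob_space B by (rule isos)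
  interpret C: prob_space C by (rule isos)
  have "farther A (conv C B) = (\<integral>\<^sup>+a. \<integral>\<^sup>+c. \<integral>\<^sup>+b. turn (norm b) (norm c) (norm a) \<partial>B \<partial>C \<partial>A)"
    by (rule farther_conv) (fact A B C)+
  also have "\<dots> = (\<integral>\<^sup>+c. \<integral>\<^sup>+a. \<integral>\<^sup>+b. turn (norm b) (norm c) (norm a) \<partial>B \<partial>A \<partial>C)"
    by (intro nn_integral_borel_swap isos) measurable
  also have "\<dots> = (\<integral>\<^sup>+c. \<integral>\<^sup>+b. \<integral>\<^sup>+a. turn (norm b) (norm c) (norm a) \<partial>A \<partial>B \<partial>C)"
    by (intro nn_integral_cong nn_integral_borel_swap isos) measurable
  finally have 1: "farther A (conv C B) = \<dots>" .
  have "farther B (conv A C) = (\<integral>\<^sup>+b. \<integral>\<^sup>+a. \<integral>\<^sup>+c. turn (norm c) (norm a) (norm b) \<partial>C \<partial>A \<partial>B)"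
    by (rule farther_conv) (fact A B C)+
  also have "\<dots> = (\<integral>\<^sup>+b. \<integral>\<^sup>+c. \<integral>\<^sup>+a. turn (norm c) (norm a) (norm b) \<partial>A \<partial>C \<partial>B)"
    by (intro nn_integral_cong nn_integral_borel_swap isos) measurable
  also have "\<dots> = (\<integral>\<^sup>+c. \<integral>\<^sup>+b. \<integral>\<^sup>+a. turn (norm c) (norm a) (norm b) \<partial>A \<partial>B \<partial>C)"
    by (intro nn_integral_borel_swap isos) measurable
  finally have 2: "farther B (conv A C) = \<dots>" .
  have "farther C (conv B A) + farther A (conv C B) + farther B (conv A C)
    = (\<integral>\<^sup>+c. \<integral>\<^sup>+b. \<integral>\<^sup>+a. turn (norm a) (norm b) (norm c) + turn (norm b) (norm c) (norm a)
        + turn (norm c) (norm a) (norm b) \<partial>A \<partial>B \<partial>C)"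
    unfolding 1 2 farther_conv[OF A B C(1)]
    by (simp add: nn_integral_add)
  also have "\<dots> = (\<integral>\<^sup>+c. \<integral>\<^sup>+b. \<integral>\<^sup>+a. 1 \<partial>A \<partial>B \<partial>C)"
  proof (intro nn_integral_cong_AE, use AE_neq_0[OF C] in eventually_elim)
    case c: (elim c)
    show ?case
    proof (intro nn_integral_cong_AE, use AE_neq_0[OF B] in eventually_elim)
      case b: (elim b)
      show ?case
        by (intro nn_integral_cong_AE, use AE_neq_0[OF A] in eventually_elim)
           (use b c in \<open>simp add: turn_cyclic_sum\<close>)
    qed
  qed
  also have "\<dots> = 1"
    by (simp add: A.emeasure_space_1 B.emeasure_space_1 C.emeasure_space_1)
  finally show ?thesis .
qed

text \<open>Once two positive lengths are fixed, hitting the circle of radius \<open>r\<close>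
  forces \<open>Re u\<close> to a single value, which has probability 0.\<close>

lemma conv_circle_null:
  assumes A: "isotropic A" "emeasure A {0} = 0" and B: "isotropic B" "emeasure B {0} = 0"
  shows "(\<integral>\<^sup>+w. indicator {r} (norm w) \<partial>conv B A) = 0"
proof -
  have circ: "(\<integral>\<^sup>+u. indicator {r} (norm (of_real x * u + of_real y)) \<partial>uniform_circle) = 0"
    if "x > 0" "y > 0" for x y
  proof -
    have "(\<integral>\<^sup>+u. indicator {r} (norm (of_real x * u + of_real y)) \<partial>uniform_circle)
      = (\<integral>\<^sup>+u. indicator {u. norm (of_real x * u + of_real y) = r} u \<partial>uniform_circle)"
      by (intro nn_integral_cong) (auto split: split_indicator)
    also have "\<dots> = emeasure uniform_circle {u. norm (of_real x * u + of_real y) = r}"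
      by (rule nn_integral_indicator) simp
    finally show ?thesis using emeasure_uniform_circle_norm_eq[OF that] by simp
  qed
  have "(\<integral>\<^sup>+w. indicator {r} (norm w) \<partial>conv B A)
    = (\<integral>\<^sup>+b. \<integral>\<^sup>+a. indicator {r} (norm (b + a) :: real) \<partial>A \<partial>B)"
    by (rule nn_integral_conv) (simp_all add: isotropicD(1,2) A B)
  also have "\<dots> = (\<integral>\<^sup>+b. 0 \<partial>B)"
  proof (intro nn_integral_cong_AE, use AE_neq_0[OF B] in eventually_elim)
    case (elim b)
    have "(\<integral>\<^sup>+a. indicator {r} (norm (b + a)) \<partial>A)
      = (\<integral>\<^sup>+a. \<integral>\<^sup>+u. indicator {r} (norm (of_real (norm a) * u + of_real (norm b))) \<partial>uniform_circle \<partial>A)"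
      by (rule isotropic_average_norm[OF A elim]) measurable
    also have "\<dots> = (\<integral>\<^sup>+a. 0 \<partial>A)"
      by (intro nn_integral_cong_AE, use AE_neq_0[OF A] in eventually_elim) (use elim in \<open>simp add: circ\<close>)
    finally show ?case by simp
  qed
  finally show ?thesis by simp
qed

text \<open>The two indicators add up to 1 plus the indicator of a tie, and for each fixed
  \<open>a\<close> a tie puts \<open>b\<close> on one circle around the origin.\<close>

lemma farther_swap:
  assumes A: "isotropic A" and B: "isotropic B" and tie: "\<And>r. (\<integral>\<^sup>+b. indicator {r} (norm b) \<partial>B) = 0"
  shows "farther A B + farther B A = 1"
proof -
  note [measurable_cong] = A[THEN sets_isotropic] B[THEN sets_isotropic]
  note isos = isotropicD(1,2)[OF A] isotropicD(1,2)[OF B]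
  interpret A: prob_space A by (rule isos)
  interpret B: prob_space B by (rule isos)
  have "farther B A = (\<integral>\<^sup>+a. \<integral>\<^sup>+b. indicator {..norm b} (norm a) \<partial>B \<partial>A)"
    unfolding farther_def by (intro nn_integral_borel_swap isos) measurable
  then have "farther A B + farther B A
    = (\<integral>\<^sup>+a. \<integral>\<^sup>+b. indicator {..norm a} (norm b) + indicator {..norm b} (norm a) \<partial>B \<partial>A)"
    by (simp add: farther_def nn_integral_add)
  also have "\<dots> = (\<integral>\<^sup>+a. \<integral>\<^sup>+b. 1 + indicator {norm a} (norm b) \<partial>B \<partial>A)"
    by (intro nn_integral_cong) (auto split: split_indicator)
  also have "\<dots> = 1"
    by (simp add: nn_integral_add tie A.emeasure_space_1 B.emeasure_space_1)
  finally show ?thesis .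
qed

subsection \<open>Random walks\<close>

text \<open>Comparing \<open>swap\<close> at \<open>j + 1\<close> with \<open>cyclic\<close> at
  \<open>j\<close>, 1, \<open>T - j - 1\<close> gives h(j + 1) = h(j) + h(1); \<open>swap\<close> at
  1 then fixes h(1) = 1 / T.\<close>

lemma additive_fraction:
  fixes h :: "nat \<Rightarrow> real"
  assumes swap: "\<And>k. 0 < k \<Longrightarrow> k < T \<Longrightarrow> h k + h (T - k) = 1"
    and cyclic: "\<And>i j k. 0 < i \<Longrightarrow> 0 < j \<Longrightarrow> 0 < k \<Longrightarrow> i + j + k = T \<Longrightarrow> h i + h j + h k = 1"
    and k: "0 < k" "k < T"
  shows "h k = real k / real T"
proof -
  have mult: "h j = real j * h 1" if "0 < j" "j < T" for j
    using that
  proof (induction j)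
    case (Suc j)
    show ?case
    proof (cases "j = 0")
      case False
      have "h (Suc j) + h (T - Suc j) = 1" using Suc.prems by (intro swap) auto
      moreover have "h j + h 1 + h (T - Suc j) = 1" using Suc.prems False by (intro cyclic) auto
      moreover have "h j = real j * h 1" using Suc False by auto
      ultimately show ?thesis by (simp add: algebra_simps)
    qed simp
  qed simp
  have "T > 1" using k by simp
  then have "h 1 + real (T - 1) * h 1 = 1"
    using swap[of 1] mult[of "T - 1"] by simp
  then have "real T * h 1 = 1" using \<open>T > 1\<close> by (simp add: algebra_simps)
  then show ?thesis using mult[OF k] \<open>T > 1\<close> by (simp add: field_simps)
qed

text \<open>Here \<open>N\<close> is the probability space carrying the step length, not the number
  of steps as in the overview; the latter is \<open>m + n\<close>, later \<open>T\<close>.\<close>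

locale planar_walk = prob_space N for N :: "'b measure" +
  fixes X :: "'b \<Rightarrow> real"
  assumes X_measurable [measurable]: "X \<in> borel_measurable N"
    and X_pos: "\<omega> \<in> space N \<Longrightarrow> X \<omega> > 0"
begin

definition step :: "complex measure" where
  "step = distr (N \<Otimes>\<^sub>M uniform_circle) borel (\<lambda>(\<omega>, u). X \<omega> *\<^sub>R u)"

text \<open>The endpoint is kept rather than its norm, since only positions can be added. The
  underlying product is that of \<open>odot_law\<close>, so taking the norm gives back that
  law.\<close>

definition walk :: "nat \<Rightarrow> complex measure" where
  "walk n = distr (Pi\<^sub>M {1..n} (\<lambda>_. N) \<Otimes>\<^sub>M Pi\<^sub>M {1..n} (\<lambda>_. uniform_circle)) borel
    (\<lambda>(\<omega>, u). \<Sum>i=1..n. X (\<omega> i) *\<^sub>R u i)"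

lemma odot_law_eq: "odot_law n N X = distr (walk n) borel norm"
  unfolding odot_law_def oplus_law_def walk_def
  by (subst distr_distr) (auto simp: comp_def case_prod_unfold)

lemma sets_walk [measurable_cong, simp]: "sets (walk n) = sets borel"
  and sets_step [measurable_cong, simp]: "sets step = sets borel"
  by (simp_all add: walk_def step_def)

lemma prob_space_step: "prob_space step"
proof -
  interpret U: prob_space uniform_circle by (rule prob_space_uniform_circle)
  interpret pair_prob_space N uniform_circle ..
  show ?thesis unfolding step_def by (rule prob_space_distr) measurable
qed

lemma prob_space_walk: "prob_space (walk n)"
  unfolding walk_def
  by (intro prob_space.prob_space_distr prob_space_pair prob_space_PiM prob_space_axioms
    prob_space_uniform_circle) measurable

lemma nn_integral_step:
  assumes [measurable]: "f \<in> borel_measurable borel"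
  shows "(\<integral>\<^sup>+s. f s \<partial>step) = (\<integral>\<^sup>+\<omega>. \<integral>\<^sup>+u. f (X \<omega> *\<^sub>R u) \<partial>uniform_circle \<partial>N)"
proof -
  interpret U: prob_space uniform_circle by (rule prob_space_uniform_circle)
  have "(\<integral>\<^sup>+s. f s \<partial>step) = (\<integral>\<^sup>+p. f (X (fst p) *\<^sub>R snd p) \<partial>(N \<Otimes>\<^sub>M uniform_circle))"
    unfolding step_def by (subst nn_integral_distr) (auto simp: case_prod_beta)
  also have "\<dots> = (\<integral>\<^sup>+\<omega>. \<integral>\<^sup>+u. f (X \<omega> *\<^sub>R u) \<partial>uniform_circle \<partial>N)"
    by (subst U.nn_integral_fst[symmetric]) auto
  finally show ?thesis .
qed

lemma nn_integral_walk:
  assumes [measurable]: "f \<in> borel_measurable borel"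
  shows "(\<integral>\<^sup>+w. f w \<partial>walk n) = (\<integral>\<^sup>+\<omega>. \<integral>\<^sup>+u. f (\<Sum>i=1..n. X (\<omega> i) *\<^sub>R u i)
    \<partial>Pi\<^sub>M {1..n} (\<lambda>_. uniform_circle) \<partial>Pi\<^sub>M {1..n} (\<lambda>_. N))"
proof -
  interpret U: prob_space "Pi\<^sub>M {1..n} (\<lambda>_. uniform_circle)"
    by (intro prob_space_PiM prob_space_uniform_circle)
  let ?g = "\<lambda>p. f (\<Sum>i=1..n. X (fst p i) *\<^sub>R snd p i)"
  have "(\<integral>\<^sup>+w. f w \<partial>walk n)
    = (\<integral>\<^sup>+p. ?g p \<partial>(Pi\<^sub>M {1..n} (\<lambda>_. N) \<Otimes>\<^sub>M Pi\<^sub>M {1..n} (\<lambda>_. uniform_circle)))"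
    unfolding walk_def by (subst nn_integral_distr) (auto simp: case_prod_beta)
  also have "\<dots> = (\<integral>\<^sup>+\<omega>. \<integral>\<^sup>+u. ?g (\<omega>, u)
    \<partial>Pi\<^sub>M {1..n} (\<lambda>_. uniform_circle) \<partial>Pi\<^sub>M {1..n} (\<lambda>_. N))"
    by (subst U.nn_integral_fst[symmetric]) auto
  finally show ?thesis by simp
qed

lemma walk_0: "walk 0 = return borel 0"
proof -
  have "prob_space (Pi\<^sub>M {1..0::nat} (\<lambda>_. N) \<Otimes>\<^sub>M Pi\<^sub>M {1..0::nat} (\<lambda>_. uniform_circle))"
    by (intro prob_space_pair prob_space_PiM prob_space_axioms prob_space_uniform_circle)
  then show ?thesis
    by (simp add: walk_def case_prod_unfold prob_space.distr_const)
qed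

text \<open>All lengths sit in one product and all directions in another, so the last step is spread
  over both. Its two coordinates are split off separately and then brought together.\<close>

lemma walk_Suc: "walk (Suc n) = conv (walk n) step"
proof (rule borel_measure_eqI_nn_integral)
  fix f :: "complex \<Rightarrow> ennreal" assume [measurable]: "f \<in> borel_measurable borel"
  interpret U: prob_space uniform_circle by (rule prob_space_uniform_circle)
  interpret step: prob_space step by (rule prob_space_step)
  interpret PN: product_sigma_finite "\<lambda>_::nat. N" by standard
  interpret PU: product_sigma_finite "\<lambda>_::nat. uniform_circle" by standard
  interpret IU: prob_space "Pi\<^sub>M {1..n} (\<lambda>_. uniform_circle)"
    by (intro prob_space_PiM prob_space_uniform_circle)
  interpret IU': prob_space "Pi\<^sub>M (insert (Suc n) {1..n}) (\<lambda>_. uniform_circle)"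
    by (intro prob_space_PiM prob_space_uniform_circle)
  interpret pair_sigma_finite N "Pi\<^sub>M {1..n} (\<lambda>_. uniform_circle)" ..
  let ?PN = "Pi\<^sub>M {1..n} (\<lambda>_. N)" and ?PU = "Pi\<^sub>M {1..n} (\<lambda>_. uniform_circle)"
  let ?s = "\<lambda>\<omega> u. \<Sum>i=1..n. X (\<omega> i) *\<^sub>R u i"
  have ins: "{1..Suc n} = insert (Suc n) {1..n}" by auto
  have upd: "(\<Sum>i=1..n. X (fun_upd \<omega> (Suc n) x i) *\<^sub>R u i) = ?s \<omega> u" for \<omega> x and u :: "nat \<Rightarrow> complex"
    by (intro sum.cong) auto
  have upd': "?s \<omega> (fun_upd u (Suc n) v) = ?s \<omega> u" for \<omega> v and u :: "nat \<Rightarrow> complex"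
    by (intro sum.cong) auto
  have "(\<integral>\<^sup>+w. f w \<partial>walk (Suc n))
    = (\<integral>\<^sup>+\<omega>. \<integral>\<^sup>+u. f (?s \<omega> u + X (\<omega> (Suc n)) *\<^sub>R u (Suc n))
      \<partial>Pi\<^sub>M (insert (Suc n) {1..n}) (\<lambda>_. uniform_circle) \<partial>Pi\<^sub>M (insert (Suc n) {1..n}) (\<lambda>_. N))"
    unfolding ins[symmetric] by (subst nn_integral_walk) simp_all
  also have "\<dots> = (\<integral>\<^sup>+\<omega>. \<integral>\<^sup>+x. \<integral>\<^sup>+u. f (?s \<omega> u + X x *\<^sub>R u (Suc n))
      \<partial>Pi\<^sub>M (insert (Suc n) {1..n}) (\<lambda>_. uniform_circle) \<partial>N \<partial>?PN)"
  proof (subst PN.product_nn_integral_insert)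
    show "(\<lambda>\<omega>. \<integral>\<^sup>+u. f (?s \<omega> u + X (\<omega> (Suc n)) *\<^sub>R u (Suc n))
      \<partial>Pi\<^sub>M (insert (Suc n) {1..n}) (\<lambda>_. uniform_circle))
      \<in> borel_measurable (Pi\<^sub>M (insert (Suc n) {1..n}) (\<lambda>_. N))"
      by measurable
  qed (simp_all only: upd fun_upd_same, simp_all)
  also have "\<dots> = (\<integral>\<^sup>+\<omega>. \<integral>\<^sup>+x. \<integral>\<^sup>+u. \<integral>\<^sup>+v. f (?s \<omega> u + X x *\<^sub>R v) \<partial>uniform_circle \<partial>?PU \<partial>N \<partial>?PN)"
  proof (intro nn_integral_cong, subst PU.product_nn_integral_insert)
    fix \<omega> x
    assume [measurable]: "\<omega> \<in> space ?PN" "x \<in> space N"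
    show "(\<lambda>u. f (?s \<omega> u + X x *\<^sub>R u (Suc n)))
      \<in> borel_measurable (Pi\<^sub>M (insert (Suc n) {1..n}) (\<lambda>_. uniform_circle))"
      by measurable
  qed (simp_all only: upd' fun_upd_same, simp_all)
  \<comment> \<open>The last length moves inside the earlier directions, next to its own direction
    \<open>v\<close>; the two inner integrals then form one \<open>step\<close>.\<close>
  also have "\<dots> = (\<integral>\<^sup>+\<omega>. \<integral>\<^sup>+u. \<integral>\<^sup>+x. \<integral>\<^sup>+v. f (?s \<omega> u + X x *\<^sub>R v) \<partial>uniform_circle \<partial>N \<partial>?PU \<partial>?PN)"
    by (intro nn_integral_cong Fubini'[symmetric]) measurable
  also have "\<dots> = (\<integral>\<^sup>+\<omega>. \<integral>\<^sup>+u. \<integral>\<^sup>+s. f (?s \<omega> u + s) \<partial>step \<partial>?PU \<partial>?PN)"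
    by (intro nn_integral_cong) (simp add: nn_integral_step)
  also have "\<dots> = (\<integral>\<^sup>+w. \<integral>\<^sup>+s. f (w + s) \<partial>step \<partial>walk n)"
    by (subst nn_integral_walk) simp_all
  also have "\<dots> = (\<integral>\<^sup>+w. f w \<partial>conv (walk n) step)"
    by (rule nn_integral_conv[symmetric]) (simp_all add: prob_space_walk prob_space_step)
  finally show "(\<integral>\<^sup>+w. f w \<partial>walk (Suc n)) = (\<integral>\<^sup>+w. f w \<partial>conv (walk n) step)" .
qed simp_all

lemma walk_add: "walk (m + n) = conv (walk m) (walk n)"
proof (induction n)
  case 0
  show ?case
  proof (rule borel_measure_eqI_nn_integral)
    fix f :: "complex \<Rightarrow> ennreal" assume [measurable]: "f \<in> borel_measurable borel"
    show "(\<integral>\<^sup>+w. f w \<partial>walk (m + 0)) = (\<integral>\<^sup>+w. f w \<partial>conv (walk m) (walk 0))"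
      using prob_space_walk[of 0]
      by (subst nn_integral_conv) (simp_all add: prob_space_walk walk_0 nn_integral_return)
  qed simp_all
next
  case (Suc n)
  then show ?case by (simp add: walk_Suc conv_assoc prob_space_walk prob_space_step)
qed

lemma isotropic_step: "isotropic step"
proof (rule isotropicI)
  fix c :: complex and f :: "complex \<Rightarrow> ennreal"
  assume c: "norm c = 1" and [measurable]: "f \<in> borel_measurable borel"
  have "(\<integral>\<^sup>+u. f (X \<omega> *\<^sub>R (c * u)) \<partial>uniform_circle) = (\<integral>\<^sup>+u. f (X \<omega> *\<^sub>R u) \<partial>uniform_circle)" for \<omega>
    by (rule nn_integral_uniform_circle_rotate[OF _ c, of "\<lambda>u. f (X \<omega> *\<^sub>R u)"]) measurable
  then show "(\<integral>\<^sup>+s. f (c * s) \<partial>step) = (\<integral>\<^sup>+s. f s \<partial>step)"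
    by (simp add: nn_integral_step)
qed (simp_all add: prob_space_step)

lemma isotropic_walk: "isotropic (walk n)"
proof (induction n)
  case 0
  show ?case
    using prob_space_walk[of 0] by (intro isotropicI) (simp_all add: walk_0 nn_integral_return)
next
  case (Suc n)
  then show ?case by (simp add: walk_Suc isotropic_conv isotropic_step)
qed

section \<open>Atoms, ties and the resulting identities for walks\<close>

lemma step_singleton: "emeasure step {z} = 0"
proof -
  have *: "(\<integral>\<^sup>+u. indicator {z} (X \<omega> *\<^sub>R u) \<partial>uniform_circle) = 0" if "\<omega> \<in> space N" for \<omega>
  proof -
    have "(\<integral>\<^sup>+u. indicator {z} (X \<omega> *\<^sub>R u) \<partial>uniform_circle)
      \<le> (\<integral>\<^sup>+u. indicator {u. Re u = Re z / X \<omega>} u \<partial>uniform_circle)"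
      using X_pos[OF that] by (intro nn_integral_mono) (auto split: split_indicator)
    also have "\<dots> = emeasure uniform_circle {u. Re u = Re z / X \<omega>}"
      by (rule nn_integral_indicator) simp
    finally show ?thesis by (simp add: emeasure_uniform_circle_Re_eq)
  qed
  have "emeasure step {z} = (\<integral>\<^sup>+s. indicator {z} s \<partial>step)" by simp
  also have "\<dots> = (\<integral>\<^sup>+\<omega>. 0 \<partial>N)"
    by (subst nn_integral_step) (auto simp: * cong: nn_integral_cong)
  finally show ?thesis by simp
qed

text \<open>A return to the origin forces the last step to be the negative of the position before
  it, and \<open>step\<close> has no atoms.\<close>

lemma walk_0_null:
  assumes "n > 0"
  shows "emeasure (walk n) {0} = 0"
proof -
  obtain k where n: "n = Suc k" using assms by (cases n) auto
  have "emeasure (walk n) {0} = (\<integral>\<^sup>+w. indicator {0} w \<partial>walk n)" by simp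
  also have "\<dots> = (\<integral>\<^sup>+w. \<integral>\<^sup>+s. indicator {0} (w + s) \<partial>step \<partial>walk k)"
    unfolding n walk_Suc by (rule nn_integral_conv) (simp_all add: prob_space_walk prob_space_step)
  also have "\<dots> = (\<integral>\<^sup>+w. \<integral>\<^sup>+s. indicator {- w} s \<partial>step \<partial>walk k)"
    by (intro nn_integral_cong) (auto simp: eq_neg_iff_add_eq_0 add.commute split: split_indicator)
  finally show ?thesis by (simp add: step_singleton)
qed

text \<open>Two steps are required: a single step of constant length stays on one circle. With
  \<open>n \<ge> 2\<close> both pieces of the split \<open>(n - 1) + 1\<close> avoid the origin
  almost surely.\<close>

lemma walk_circle_null:
  assumes "n \<ge> 2"
  shows "(\<integral>\<^sup>+w. indicator {r} (norm w) \<partial>walk n) = 0"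
proof -
  have n: "n = (n - 1) + 1" using assms by simp
  show ?thesis
    by (subst n, subst walk_add) (rule conv_circle_null, use assms in \<open>auto simp: isotropic_walk walk_0_null\<close>)
qed

text \<open>One of the two walks has at least two steps and hence charges no circle;
  \<open>farther_swap\<close> expects it as second argument, whence the case split.\<close>

lemma farther_walk_swap:
  assumes "m + n > 2"
  shows "farther (walk m) (walk n) + farther (walk n) (walk m) = 1"
proof (cases "n \<ge> 2")
  case True
  then show ?thesis by (intro farther_swap isotropic_walk walk_circle_null)
next
  case False
  then have "farther (walk n) (walk m) + farther (walk m) (walk n) = 1"
    using assms by (intro farther_swap isotropic_walk walk_circle_null) auto
  then show ?thesis by (simp add: add.commute)
qed

lemma farther_walk_cyclic:
  assumes "i > 0" "j > 0" "k > 0"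
  shows "farther (walk k) (walk (i + j)) + farther (walk i) (walk (j + k)) + farther (walk j) (walk (k + i)) = 1"
proof -
  have "walk (i + j) = conv (walk j) (walk i)" "walk (j + k) = conv (walk k) (walk j)"
    "walk (k + i) = conv (walk i) (walk k)"
    by (simp_all flip: walk_add add: add.commute)
  then show ?thesis
    using assms by (simp add: farther_cyclic_sum isotropic_walk walk_0_null)
qed

lemma farther_walk:
  assumes "m + n > 2"
  shows "farther (walk m) (walk n) = ennreal (real m / real (m + n))"
proof -
  have pos: "farther (walk m) (walk n) = ennreal (real m / real (m + n))"
    if mn: "m + n > 2" "m > 0" "n > 0" for m n
  proof -
    define T where "T = m + n"
    \<comment> \<open>\<open>enn2real\<close> sends infinity to 0, so the bound \<open>le\<close> by
      1 is what allows each probability to be recovered from \<open>h\<close>.\<close>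
    define h where "h k = enn2real (farther (walk k) (walk (T - k)))" for k
    have le: "farther (walk i) (walk j) \<le> 1" if "i + j > 2" for i j
      using farther_walk_swap[OF that] by (metis le_iff_add)
    have h: "farther (walk k) (walk (T - k)) = ennreal (h k)" if "k \<le> T" for k
    proof -
      have "farther (walk k) (walk (T - k)) \<le> 1" using that mn by (intro le) (simp add: T_def)
      then show ?thesis unfolding h_def by (auto simp: ennreal_enn2real_if top_unique)
    qed
    have h0: "h k \<ge> 0" for k by (simp add: h_def)
    have "h m = real m / real T"
    proof (rule additive_fraction)
      fix k assume "0 < k" "k < T"
      then have "farther (walk k) (walk (T - k)) + farther (walk (T - k)) (walk (T - (T - k))) = 1"
        using farther_walk_swap[of k "T - k"] mn by (simp add: T_def)
      then show "h k + h (T - k) = 1"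
        using \<open>k < T\<close> h[of k] h[of "T - k"] by (simp add: h0 flip: ennreal_plus)
    next
      fix i j k assume *: "0 < i" "0 < j" "0 < k" "i + j + k = T"
      then have "i + j = T - k" "j + k = T - i" "k + i = T - j" by auto
      then have "farther (walk k) (walk (T - k)) + farther (walk i) (walk (T - i))
          + farther (walk j) (walk (T - j)) = 1"
        using farther_walk_cyclic[of i j k] * by simp
      then show "h i + h j + h k = 1"
        using * by (simp add: h h0 add_ac flip: ennreal_plus)
    qed (use mn in \<open>auto simp: T_def\<close>)
    then show ?thesis using h[of m] by (simp add: T_def)
  qed
  \<comment> \<open>A walk without steps stays at the origin, and could only tie with a walk that
    returns there. The case \<open>n = 0\<close> follows from this by
    \<open>farther_walk_swap\<close>.\<close>
  have zero: "farther (walk 0) (walk k) = 0" if "k > 0" for k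
  proof -
    interpret W: prob_space "walk k" by (rule prob_space_walk)
    have "farther (walk 0) (walk k) = (\<integral>\<^sup>+b. indicator {..0} (norm b) \<partial>walk k)"
      unfolding farther_def walk_0 by (subst nn_integral_return) auto
    also have "\<dots> = (\<integral>\<^sup>+b. indicator {0} b \<partial>walk k)"
      by (intro nn_integral_cong) (auto split: split_indicator)
    also have "\<dots> = 0" using that by (simp add: walk_0_null)
    finally show ?thesis .
  qed
  consider "m = 0" | "n = 0" "m > 0" | "m > 0" "n > 0" by auto
  then show ?thesis
  proof cases
    case 1
    then show ?thesis using zero[of n] assms by simp
  next
    case 2
    then show ?thesis using zero[of m] farther_walk_swap[of m 0] assms by simp
  next
    case 3
    then show ?thesis using pos assms by simp
  qed
qed

end

theorem theorem1:
  fixes N :: "'b measure" and X :: "'b \<Rightarrow> real"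
    and M :: "'a measure" and Dm Dn :: "'a \<Rightarrow> real"
    and m n :: nat
  assumes "prob_space N" and "X \<in> borel_measurable N"
    and "\<And>\<omega>. \<omega> \<in> space N \<Longrightarrow> X \<omega> > 0"
    and "m + n > 2"
    and "prob_space M"
    and "prob_space.indep_var M borel Dm borel Dn"
    and "distr M borel Dm = odot_law m N X"
    and "distr M borel Dn = odot_law n N X"
  shows "measure M {\<omega> \<in> space M. Dm \<omega> > Dn \<omega>} = real m / real (m + n)"
proof -
  interpret planar_walk N X
    using assms(1-3) by (simp add: planar_walk_def planar_walk_axioms_def)
  interpret M: prob_space M by fact
  have rv [measurable]: "Dm \<in> borel_measurable M" "Dn \<in> borel_measurable M"
    and joint: "distr M borel Dm \<Otimes>\<^sub>M distr M borel Dn = distr M (borel \<Otimes>\<^sub>M borel) (\<lambda>\<omega>. (Dm \<omega>, Dn \<omega>))"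
    using assms(6) by (auto simp: M.indep_var_distribution_eq)
  interpret Wm: prob_space "walk m" by (rule prob_space_walk)
  interpret Wn: prob_space "walk n" by (rule prob_space_walk)
  interpret Dm: prob_space "distr M borel Dm" by (rule M.prob_space_distr) measurable
  interpret pair_sigma_finite "distr M borel Dm" "distr M borel Dn"
    by (simp add: pair_sigma_finite_def M.prob_space_distr prob_space_imp_sigma_finite)
  let ?le = "{p :: real \<times> real. fst p \<le> snd p}"
  have "Measurable.pred (borel \<Otimes>\<^sub>M borel) (\<lambda>p :: real \<times> real. fst p \<le> snd p)" by measurable
  then have [measurable]: "?le \<in> sets (borel \<Otimes>\<^sub>M borel)" by (simp add: pred_def space_pair_measure)
  \<comment> \<open>Since \<open>farther\<close> is non-strict, the complementary event is computed,
    with the roles of \<open>m\<close> and \<open>n\<close> exchanged; its complement is the strict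
    inequality of the claim.\<close>
  have "emeasure M {\<omega> \<in> space M. Dm \<omega> \<le> Dn \<omega>}
    = emeasure (distr M (borel \<Otimes>\<^sub>M borel) (\<lambda>\<omega>. (Dm \<omega>, Dn \<omega>))) ?le"
    by (subst emeasure_distr) (auto intro!: arg_cong[where f = "emeasure M"])
  also have "\<dots> = (\<integral>\<^sup>+p. indicator ?le p \<partial>(distr M borel Dm \<Otimes>\<^sub>M distr M borel Dn))"
    unfolding joint by simp
  also have "\<dots> = (\<integral>\<^sup>+b. \<integral>\<^sup>+a. indicator ?le (a, b) \<partial>distr M borel Dm \<partial>distr M borel Dn)"
    by (rule nn_integral_snd[symmetric]) simp
  also have "\<dots> = (\<integral>\<^sup>+b. \<integral>\<^sup>+a. indicator {..b} a \<partial>distr M borel Dm \<partial>distr M borel Dn)"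
    by (intro nn_integral_cong) (auto split: split_indicator)
  also have "\<dots> = farther (walk n) (walk m)"
    unfolding assms(7,8) odot_law_eq farther_def
    by (simp add: nn_integral_distr del: nn_integral_indicator)
  also have "\<dots> = ennreal (real n / real (m + n))"
    using farther_walk[of n m] assms(4) by (simp add: add.commute)
  finally have "measure M {\<omega> \<in> space M. Dm \<omega> \<le> Dn \<omega>} = real n / real (m + n)"
    by (simp add: measure_def)
  then have "measure M {\<omega> \<in> space M. \<not> Dm \<omega> \<le> Dn \<omega>} = 1 - real n / real (m + n)"
    by (subst M.prob_neg) auto
  also have "\<dots> = real m / real (m + n)"
    using assms(4) by (simp add: field_simps)
  finally show ?thesis by (simp add: not_le)
qed

end
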